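(* Let $n\ge1$. The association $(\mathcal{G},c)\mapsto\Phi^{\mathcal{G},c}$ restricts to a bijection between closed crystallographs on the set of nodes $\{1,\dots,n\}$ and closed root subsystems of $BC_n$.
   Context: Let $V=\mathbb{C}^n$ with canonical basis $(e_i)$, orthonormal for the scalar product, $e^\pm_{ij}=e_i\pm e_j$, and $BC_n=\{\pm e^-_{ij},\pm e^+_{ij}: i\ne j\}\cup\{\pm e_i,\pm2e_i\}$. A root subsystem is a subset $\Phi'\subseteq BC_n$ stable under the orthogonal reflections $\sigma_\alpha$ defined by its elements $\alpha\in\Phi'$. A subset $\Phi'\subseteq BC_n$ is closed if $(\Phi'+\Phi')\cap BC_n\subseteq\Phi'$. A bichromatic graph $(\mathcal{G},c)$ on nodes $\{1,\dots,n\}$ has unoriented straight edges $\{i,j\}$ ($i\ne j$) and loop edges $\{k\}$, each coloured red or green, such that two distinct edges with the same underlying node set have different colours. The set $\Phi^{\mathcal{G},c}\subseteq BC_n$ consists exactly of $\pm e^-_{ij}$ for each red straight edge $\{i,j\}$, $\pm e^+_{ij}$ for each green straight edge $\{i,j\}$, $\pm e_k$ for each red loop at $k$, and $\pm2e_k$ for each green loop at $k$. Triangle condition: for any three distinct nodes $i,j,k$, if there are straight edges $\{i,j\}$, $\{j,k\}$ then there is a straight edge $\{i,k\}$, red if the first two have the same colour and green otherwise. A bichromatic graph is a crystallograph if it satisfies the triangle condition and: if a node $i$ is incident to a loop edge and to a straight edge $\{i,j\}$, then both the red and the green straight edge $\{i,j\}$ are present, as well as a loop edge at $j$ of the same colour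 as the one at $i$. A bichromatic graph is closed if it satisfies the triangle condition and: (1) if a node is incident to a green loop edge and a straight edge, then the graph contains also the straight edge of opposite colour with the same endpoints; (2) if the graph contains both a red and a green straight edge between two nodes, then it contains green loop edges at both of these nodes; (3) if a node is incident to a red loop edge and a straight edge, then there is a red loop edge at the other end of the straight edge; (4) if two distinct nodes are incident to red loop edges, then both the red and the green straight edge between them are present; (5) if a node is incident to a red loop edge, then it is also incident to a green loop edge. A closed crystallograph is a bichromatic graph which is both a crystallograph and closed. *)

theory Defs
  imports "HOL-Analysis.Analysis"
begin

section \<open>The root system \<open>BC\<^sub>n\<close> in \<open>\<complex>\<^sup>n\<close>\<close>

text \<open>The elements of the finite index type \<open>'n\<close> play the role of \<open>1, \<dots>, n\<close>, both as indices
  of coordinates and as nodes of graphs; types being nonempty, \<open>n = CARD('n) \<ge> 1\<close>.\<close>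

definition ebasis :: "'n::finite \<Rightarrow> complex ^ 'n" where
  "ebasis i = axis i 1"

definition eminus :: "'n::finite \<Rightarrow> 'n \<Rightarrow> complex ^ 'n" where
  "eminus i j = ebasis i - ebasis j"

definition eplus :: "'n::finite \<Rightarrow> 'n \<Rightarrow> complex ^ 'n" where
  "eplus i j = ebasis i + ebasis j"

definition BC :: "(complex ^ 'n::finite) set" where
  "BC = {eminus i j | i j. i \<noteq> j} \<union> {- eminus i j | i j. i \<noteq> j}
      \<union> {eplus i j | i j. i \<noteq> j} \<union> {- eplus i j | i j. i \<noteq> j}
      \<union> {ebasis i | i. True} \<union> {- ebasis i | i. True}
      \<union> {2 *s ebasis i | i. True} \<union> {- (2 *s ebasis i) | i. True}"

text \<open>The library's inner product on \<^typ>\<open>complex ^ 'n\<close> is the real part of the following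
  Hermitian one and would give a reflection that is only real linear.\<close>

definition hermitian :: "complex ^ 'n::finite \<Rightarrow> complex ^ 'n \<Rightarrow> complex" where
  "hermitian v w = (\<Sum>i\<in>UNIV. v $ i * cnj (w $ i))"

definition refl_along :: "complex ^ 'n::finite \<Rightarrow> complex ^ 'n \<Rightarrow> complex ^ 'n" where
  "refl_along \<alpha> v = v - (2 * hermitian v \<alpha> / hermitian \<alpha> \<alpha>) *s \<alpha>"

definition root_subsystem :: "(complex ^ 'n::finite) set \<Rightarrow> bool" where
  "root_subsystem \<Phi> \<longleftrightarrow> \<Phi> \<subseteq> BC \<and> (\<forall>\<alpha>\<in>\<Phi>. refl_along \<alpha> ` \<Phi> \<subseteq> \<Phi>)"

definition closed_in_BC :: "(complex ^ 'n::finite) set \<Rightarrow> bool" where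
  "closed_in_BC \<Phi> \<longleftrightarrow> \<Phi> \<subseteq> BC \<and> {\<alpha> + \<beta> | \<alpha> \<beta>. \<alpha> \<in> \<Phi> \<and> \<beta> \<in> \<Phi>} \<inter> BC \<subseteq> \<Phi>"

definition closed_root_subsystem :: "(complex ^ 'n::finite) set \<Rightarrow> bool" where
  "closed_root_subsystem \<Phi> \<longleftrightarrow> root_subsystem \<Phi> \<and> closed_in_BC \<Phi>"


section \<open>Bichromatic graphs\<close>

datatype colour = Red | Green

fun opposite :: "colour \<Rightarrow> colour" where
  "opposite Red = Green"
| "opposite Green = Red"

text \<open>An edge is its underlying node set together with its colour. As a graph is a set of such
  pairs, distinct edges with the same underlying node set automatically have different colours.\<close>

type_synonym 'n cgraph = "('n set \<times> colour) set"

definition bichromatic_graph :: "'n cgraph \<Rightarrow> bool" where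
  "bichromatic_graph G \<longleftrightarrow>
     (\<forall>(e, c)\<in>G. (\<exists>i j. i \<noteq> j \<and> e = {i, j}) \<or> (\<exists>k. e = {k}))"

definition straight :: "'n cgraph \<Rightarrow> colour \<Rightarrow> 'n \<Rightarrow> 'n \<Rightarrow> bool" where
  "straight G c i j \<longleftrightarrow> i \<noteq> j \<and> ({i, j}, c) \<in> G"

definition loop :: "'n cgraph \<Rightarrow> colour \<Rightarrow> 'n \<Rightarrow> bool" where
  "loop G c k \<longleftrightarrow> ({k}, c) \<in> G"

definition roots_of :: "'n cgraph \<Rightarrow> (complex ^ 'n::finite) set" where
  "roots_of G =
     {eminus i j | i j. straight G Red i j} \<union> {- eminus i j | i j. straight G Red i j}
   \<union> {eplus i j | i j. straight G Green i j} \<union> {- eplus i j | i j. straight G Green i j}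
   \<union> {ebasis k | k. loop G Red k} \<union> {- ebasis k | k. loop G Red k}
   \<union> {2 *s ebasis k | k. loop G Green k} \<union> {- (2 *s ebasis k) | k. loop G Green k}"

definition triangle_condition :: "'n cgraph \<Rightarrow> bool" where
  "triangle_condition G \<longleftrightarrow>
     (\<forall>i j k c d. i \<noteq> j \<and> j \<noteq> k \<and> i \<noteq> k \<and> straight G c i j \<and> straight G d j k
        \<longrightarrow> straight G (if c = d then Red else Green) i k)"

definition crystallograph :: "'n cgraph \<Rightarrow> bool" where
  "crystallograph G \<longleftrightarrow> bichromatic_graph G \<and> triangle_condition G \<and>
     (\<forall>i j c d. loop G c i \<and> straight G d i j
        \<longrightarrow> straight G Red i j \<and> straight G Green i j \<and> loop G c j)"

definition closed_graph :: "'n cgraph \<Rightarrow> bool" where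
  "closed_graph G \<longleftrightarrow> bichromatic_graph G \<and> triangle_condition G \<and>
     (\<forall>i j c. loop G Green i \<and> straight G c i j \<longrightarrow> straight G (opposite c) i j) \<and>
     (\<forall>i j. straight G Red i j \<and> straight G Green i j \<longrightarrow> loop G Green i \<and> loop G Green j) \<and>
     (\<forall>i j c. loop G Red i \<and> straight G c i j \<longrightarrow> loop G Red j) \<and>
     (\<forall>i j. i \<noteq> j \<and> loop G Red i \<and> loop G Red j \<longrightarrow> straight G Red i j \<and> straight G Green i j) \<and>
     (\<forall>i. loop G Red i \<longrightarrow> loop G Green i)"

definition closed_crystallograph :: "'n cgraph \<Rightarrow> bool" where
  "closed_crystallograph G \<longleftrightarrow> crystallograph G \<and> closed_graph G"

end

theory Submission
  imports Defs
begin

text \<open>Adjoin the origin to the signed basis vectors and consider the points \<open>0, \<plusminus>e\<^sub>1, \<dots>, \<plusminus>e\<^sub>n\<close>.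
  Every root of \<open>BC\<^sub>n\<close> is a difference of two distinct points: \<open>\<plusminus>e\<^sub>i\<close> involves the origin,
  \<open>2e\<^sub>i = e\<^sub>i - (-e\<^sub>i)\<close>, and the remaining roots are differences of signed basis vectors belonging to
  distinct indices. Up to the symmetry \<open>x - y = (-y) - (-x)\<close> this presentation is unique
  (\<open>difference_unique\<close>). A set \<open>\<Phi>\<close> of roots therefore amounts to a relation on the points, namely
  \<open>x \<sim> y\<close> iff \<open>x - y\<close> is \<open>0\<close> or lies in \<open>\<Phi>\<close>.

  Both sides of the bijection consist of those \<open>\<Phi>\<close> for which this is an equivalence relation.

  For root subsystems, closedness under sums says that \<open>\<sim>\<close> is transitive, because two roots whose
  sum is a root can always be written as \<open>x - y\<close> and \<open>y - z\<close> (\<open>root_sum_composable\<close>): without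
  such a cancellation the sum would involve at least three signed basis vectors. The reflection
  along a root sends that root to its negative, which makes \<open>\<sim>\<close> symmetric; conversely, if \<open>\<sim>\<close> is an equivalence relation, the reflection along \<open>x - y\<close> with
  \<open>x \<sim> y\<close> moves points only within their equivalence classes (\<open>refl_along_in_block\<close>) and hence
  preserves \<open>\<Phi>\<close>.

  For graphs, a red edge \<open>{i, j}\<close> says \<open>e\<^sub>i \<sim> e\<^sub>j\<close>, a green edge \<open>e\<^sub>i \<sim> -e\<^sub>j\<close>, a red loop
  \<open>e\<^sub>i \<sim> 0\<close> and a green loop \<open>e\<^sub>i \<sim> -e\<^sub>i\<close>. Read in this way, the triangle condition, the
  crystallograph condition and the five closedness conditions together are the transitivity of
  \<open>\<sim>\<close>, spelled out according to the kinds of points involved.\<close>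

section \<open>Roots as differences of signed points\<close>

datatype 'n point = Origin | Pos 'n | Neg 'n

fun opp :: "'n point \<Rightarrow> 'n point" where
  "opp Origin = Origin"
| "opp (Pos i) = Neg i"
| "opp (Neg i) = Pos i"

fun vec_of :: "'n::finite point \<Rightarrow> complex ^ 'n" where
  "vec_of Origin = 0"
| "vec_of (Pos i) = ebasis i"
| "vec_of (Neg i) = - ebasis i"

lemma opp_opp [simp]: "opp (opp p) = p"
  by (cases p) auto

lemma opp_eq_iff [simp]: "opp p = opp q \<longleftrightarrow> p = q"
  by (metis opp_opp)

lemma opp_eq_self_iff [simp]: "opp p = p \<longleftrightarrow> p = Origin" "p = opp p \<longleftrightarrow> p = Origin"
  by (cases p; auto)+

lemma opp_eq_Origin_iff [simp]: "opp p = Origin \<longleftrightarrow> p = Origin" "Origin = opp p \<longleftrightarrow> p = Origin"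
  by (cases p; simp)+

lemma vec_of_opp [simp]: "vec_of (opp p) = - vec_of p"
  by (cases p) auto

lemma ebasis_nth: "ebasis i $ k = (if k = i then 1 else 0)"
  by (simp add: ebasis_def axis_def)

lemma two_smult: "2 *s v = v + (v :: complex ^ 'n)"
  by (simp add: vec_eq_iff)

lemma vec_of_diff:
  "vec_of (Pos i) - vec_of (Pos j) = eminus i j"
  "vec_of (Neg i) - vec_of (Neg j) = - eminus i j"
  "vec_of (Pos i) - vec_of (Neg j) = (if i = j then 2 *s ebasis i else eplus i j)"
  "vec_of (Neg i) - vec_of (Pos j) = (if i = j then - (2 *s ebasis i) else - eplus i j)"
  "vec_of (Pos i) - vec_of Origin = ebasis i" "vec_of (Neg i) - vec_of Origin = - ebasis i"
  "vec_of Origin - vec_of (Pos i) = - ebasis i" "vec_of Origin - vec_of (Neg i) = ebasis i"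
  by (simp_all add: eminus_def eplus_def two_smult)

text \<open>The points that a graph declares equivalent. The two equations with \<open>Green\<close> need no case
  distinction: for \<open>i = j\<close> the set \<open>{i, j}\<close> is a singleton, so a green loop is a green edge from
  \<open>i\<close> to itself, in accordance with \<open>2e\<^sub>i = e\<^sub>i + e\<^sub>i\<close>.\<close>

fun linked :: "'n cgraph \<Rightarrow> 'n point \<Rightarrow> 'n point \<Rightarrow> bool" where
  "linked G Origin Origin \<longleftrightarrow> False"
| "linked G Origin (Pos j) \<longleftrightarrow> ({j}, Red) \<in> G"
| "linked G Origin (Neg j) \<longleftrightarrow> ({j}, Red) \<in> G"
| "linked G (Pos i) Origin \<longleftrightarrow> ({i}, Red) \<in> G"
| "linked G (Neg i) Origin \<longleftrightarrow> ({i}, Red) \<in> G"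
| "linked G (Pos i) (Pos j) \<longleftrightarrow> i \<noteq> j \<and> ({i, j}, Red) \<in> G"
| "linked G (Neg i) (Neg j) \<longleftrightarrow> i \<noteq> j \<and> ({i, j}, Red) \<in> G"
| "linked G (Pos i) (Neg j) \<longleftrightarrow> ({i, j}, Green) \<in> G"
| "linked G (Neg i) (Pos j) \<longleftrightarrow> ({i, j}, Green) \<in> G"

lemma linked_neq: "linked G x y \<Longrightarrow> x \<noteq> y"
  by (cases x; cases y) auto

lemma linked_sym: "linked G x y \<Longrightarrow> linked G y x"
  by (cases x; cases y) (auto simp: insert_commute)

lemma linked_opp: "linked G (opp y) (opp x) \<longleftrightarrow> linked G x y"
  by (cases x; cases y) (auto simp: insert_commute)

lemma roots_of_eq_differences: "roots_of G = {vec_of x - vec_of y | x y. linked G x y}" (is "_ = ?D")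
proof
  have D: "v \<in> ?D" if "linked G x y" "v = vec_of x - vec_of y" for x y :: "'a point" and v
    using that by blast
  show "roots_of G \<subseteq> ?D"
  proof
    fix v assume "v \<in> roots_of G"
    from this[unfolded roots_of_def Un_iff mem_Collect_eq] show "v \<in> ?D"
    proof (elim disjE exE conjE)
      show ?thesis if "v = eminus i j" "straight G Red i j" for i j
        using D[of "Pos i" "Pos j" v] that unfolding vec_of_diff by (simp add: straight_def)
      show ?thesis if "v = - eminus i j" "straight G Red i j" for i j
        using D[of "Neg i" "Neg j" v] that unfolding vec_of_diff by (simp add: straight_def)
      show ?thesis if "v = eplus i j" "straight G Green i j" for i j
        using D[of "Pos i" "Neg j" v] that unfolding vec_of_diff by (simp add: straight_def)
      show ?thesis if "v = - eplus i j" "straight G Green i j" for i j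
        using D[of "Neg i" "Pos j" v] that unfolding vec_of_diff by (simp add: straight_def)
      show ?thesis if "v = ebasis i" "loop G Red i" for i
        using D[of "Pos i" Origin v] that unfolding vec_of_diff by (simp add: loop_def)
      show ?thesis if "v = - ebasis i" "loop G Red i" for i
        using D[of "Neg i" Origin v] that unfolding vec_of_diff by (simp add: loop_def)
      show ?thesis if "v = 2 *s ebasis i" "loop G Green i" for i
        using D[of "Pos i" "Neg i" v] that unfolding vec_of_diff by (simp add: loop_def)
      show ?thesis if "v = - (2 *s ebasis i)" "loop G Green i" for i
        using D[of "Neg i" "Pos i" v] that unfolding vec_of_diff by (simp add: loop_def)
    qed
  qed
  have "vec_of x - vec_of y \<in> roots_of G" if "linked G x y" for x y
  proof -
    have "straight G Red i j \<Longrightarrow> eminus i j \<in> roots_of G" "straight G Red i j \<Longrightarrow> - eminus i j \<in> roots_of G"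
      "straight G Green i j \<Longrightarrow> eplus i j \<in> roots_of G" "straight G Green i j \<Longrightarrow> - eplus i j \<in> roots_of G"
      "loop G Red i \<Longrightarrow> ebasis i \<in> roots_of G" "loop G Red i \<Longrightarrow> - ebasis i \<in> roots_of G"
      "loop G Green i \<Longrightarrow> 2 *s ebasis i \<in> roots_of G" "loop G Green i \<Longrightarrow> - (2 *s ebasis i) \<in> roots_of G"
      for i j
      unfolding roots_of_def Un_iff mem_Collect_eq by metis+
    with that show ?thesis
      by (cases x; cases y; simp only: vec_of_diff linked.simps straight_def loop_def split: if_split) auto
  qed
  then show "?D \<subseteq> roots_of G" by blast
qed

lemma BC_eq_differences: "(BC :: (complex ^ 'n::finite) set) = {vec_of x - vec_of y | x y. x \<noteq> y}"
proof -
  \<comment> \<open>The whole root system belongs to the graph that has all edges in both colours.\<close>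
  have "(BC :: (complex ^ 'n) set) = roots_of UNIV"
    by (simp add: BC_def roots_of_def straight_def loop_def)
  moreover have "linked UNIV x y \<longleftrightarrow> x \<noteq> y" for x y :: "'n point"
    by (cases x; cases y) auto
  ultimately show ?thesis
    by (simp add: roots_of_eq_differences)
qed

lemma inj_vec_of [simp]: "vec_of x = vec_of y \<longleftrightarrow> x = y"
proof
  assume "vec_of x = vec_of y"
  then have "vec_of x $ k = vec_of y $ k" for k by simp
  from this[of "case x of Pos i \<Rightarrow> i | Neg i \<Rightarrow> i | Origin \<Rightarrow> undefined"]
    this[of "case y of Pos i \<Rightarrow> i | Neg i \<Rightarrow> i | Origin \<Rightarrow> undefined"]
  show "x = y"
    by (cases x; cases y; auto simp: ebasis_nth split: if_splits)
qed simp

section \<open>Sums without cancellation\<close>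

text \<open>Signed basis vectors among which no two are opposite belong to distinct indices, so a
  signed sum of real parts of coordinates takes the value 1 on all of them. On a sum of such vectors it counts the
  terms, whereas on a difference of two points it is at most 2.\<close>

lemma detecting_functional:
  fixes S :: "'n::finite point set"
  assumes S: "\<And>p. p \<in> S \<Longrightarrow> opp p \<in> S \<Longrightarrow> p = Origin"
  obtains f :: "complex ^ 'n \<Rightarrow> real" where "linear f"
    "\<And>p. p \<in> S \<Longrightarrow> p \<noteq> Origin \<Longrightarrow> f (vec_of p) = 1" "\<And>p. \<bar>f (vec_of p)\<bar> \<le> 1"
proof
  define c :: "'n \<Rightarrow> real" where "c k = (if Pos k \<in> S then 1 else if Neg k \<in> S then -1 else 0)" for k
  define f where "f v = (\<Sum>k\<in>UNIV. c k * Re (v $ k))" for v :: "complex ^ 'n"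
  show lin: "linear f"
    by (rule linearI) (simp_all add: f_def algebra_simps sum.distrib sum_distrib_left)
  have e: "f (ebasis i) = c i" for i
    by (simp add: f_def ebasis_nth if_distrib cong: if_cong)
  have v: "f (vec_of p) = (case p of Origin \<Rightarrow> 0 | Pos i \<Rightarrow> c i | Neg i \<Rightarrow> - c i)" for p
    by (cases p) (simp_all add: e linear_0[OF lin] linear_neg[OF lin])
  show "f (vec_of p) = 1" if "p \<in> S" "p \<noteq> Origin" for p
    using that S[of p] v[of p] by (cases p) (auto simp: c_def)
  show "\<bar>f (vec_of p)\<bar> \<le> 1" for p
    using v[of p] by (cases p) (auto simp: c_def)
qed

text \<open>If none of the four points \<open>x\<close>, \<open>-y\<close>, \<open>z\<close>, \<open>-w\<close> is opposite to another one, then at most one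
  of them is the origin, because the origin is opposite to itself. So the left-hand side is a sum
  of at least three signed basis vectors without cancellation, too many for a difference of two
  points. The points \<open>a\<close> and \<open>b\<close> may coincide, so that a vanishing sum is covered as well.\<close>

lemma root_sum_cancels:
  fixes x y z w a b :: "'n::finite point"
  assumes "x \<noteq> y" "z \<noteq> w"
    and root: "(vec_of x - vec_of y) + (vec_of z - vec_of w) = vec_of a - vec_of b"
  shows "y = z \<or> w = x \<or> z = opp x \<or> w = opp y"
proof (rule ccontr)
  assume neg: "\<not> ?thesis"
  \<comment> \<open>The terms of the left-hand side; two of them are opposite exactly in the cases of the claim
    and in the excluded cases \<open>x = y\<close> and \<open>z = w\<close>.\<close>
  let ?S = "{x, opp y, z, opp w}"
  have S: "p = Origin" if "p \<in> ?S" "opp p \<in> ?S" for p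
    using that assms(1,2) neg by auto
  obtain f :: "complex ^ 'n \<Rightarrow> real" where lin: "linear f"
    and one: "\<And>p. p \<in> ?S \<Longrightarrow> p \<noteq> Origin \<Longrightarrow> f (vec_of p) = 1"
    and le: "\<And>p. \<bar>f (vec_of p)\<bar> \<le> 1"
    using detecting_functional[of ?S] S by blast
  have "f (vec_of x + vec_of (opp y) + vec_of z + vec_of (opp w)) = f (vec_of a - vec_of b)"
    unfolding root[symmetric] by (simp add: algebra_simps)
  then have "f (vec_of x) + f (vec_of (opp y)) + f (vec_of z) + f (vec_of (opp w))
      = f (vec_of a) - f (vec_of b)"
    unfolding linear_add[OF lin] linear_diff[OF lin] .
  moreover have "f (vec_of Origin) = 0"
    using linear_0[OF lin] by simp
  moreover have "f (vec_of a) - f (vec_of b) \<le> 2"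
    using le[of a] le[of b] by linarith
  ultimately show False
    using one[of x] one[of "opp y"] one[of z] one[of "opp w"] neg assms(1,2)
    by (cases "x = Origin"; cases "y = Origin"; cases "z = Origin"; cases "w = Origin")
      (simp_all del: vec_of_opp)
qed

lemma difference_unique:
  assumes "x \<noteq> y" and eq: "vec_of x - vec_of y = vec_of z - vec_of w"
  shows "z = x \<and> w = y \<or> z = opp y \<and> w = opp x"
proof -
  have "z \<noteq> w" using assms by (metis eq_iff_diff_eq_0 inj_vec_of)
  \<comment> \<open>The difference of the two presentations vanishes, so two of its terms cancel.\<close>
  have "(vec_of x - vec_of y) + (vec_of w - vec_of z) = vec_of Origin - vec_of Origin"
    using eq by simp
  from root_sum_cancels[OF \<open>x \<noteq> y\<close> _ this] \<open>z \<noteq> w\<close>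
  consider "y = w" | "z = x" | "w = opp x" | "z = opp y" by auto
  then show ?thesis
  proof cases
    case 1
    then show ?thesis using eq by auto
  next
    case 2
    then show ?thesis using eq by auto
  next
    case 3
    then have "vec_of z = vec_of (opp y)" using eq by (simp add: algebra_simps eq_neg_iff_add_eq_0)
    then have "z = opp y" unfolding inj_vec_of .
    then show ?thesis using 3 by blast
  next
    case 4
    then have "vec_of w = vec_of (opp x)" using eq by (simp add: algebra_simps eq_neg_iff_add_eq_0)
    then have "w = opp x" unfolding inj_vec_of .
    then show ?thesis using 4 by blast
  qed
qed

text \<open>Each of the four possible cancellations takes this form once \<open>\<alpha>\<close> or \<open>\<beta>\<close>, or both, are
  rewritten by \<open>x - y = (-y) - (-x)\<close>. This is what turns closedness under sums into transitivity.\<close>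

lemma root_sum_composable:
  assumes "\<alpha> \<in> BC" "\<beta> \<in> BC" "\<alpha> + \<beta> \<in> BC"
  obtains x y z where "\<alpha> = vec_of x - vec_of y" "\<beta> = vec_of y - vec_of z"
proof -
  obtain x y where xy: "x \<noteq> y" "\<alpha> = vec_of x - vec_of y"
    using assms(1) by (auto simp: BC_eq_differences)
  obtain z w where zw: "z \<noteq> w" "\<beta> = vec_of z - vec_of w"
    using assms(2) by (auto simp: BC_eq_differences)
  obtain a b where ab: "\<alpha> + \<beta> = vec_of a - vec_of b"
    using assms(3) by (auto simp: BC_eq_differences)
  have flip: "vec_of p - vec_of q = vec_of (opp q) - vec_of (opp p)" for p q :: "'a point"
    by simp
  from root_sum_cancels[OF xy(1) zw(1) ab[unfolded xy zw]]
  consider "y = z" | "w = x" | "z = opp x" | "w = opp y" by blast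
  then show ?thesis
  proof cases
    case 1
    then show ?thesis using xy zw that by blast
  next
    case 2
    then show ?thesis using xy zw flip that by metis
  next
    case 3
    then show ?thesis using xy zw flip[of x y] that by metis
  next
    case 4
    then show ?thesis using xy zw flip[of z w] that by (metis opp_opp)
  qed
qed

section \<open>Reflections\<close>

lemma hermitian_diff_left: "hermitian (u - v) w = hermitian u w - hermitian v w"
  by (simp add: hermitian_def sum_subtractf algebra_simps)

lemma hermitian_diff_right: "hermitian u (v - w) = hermitian u v - hermitian u w"
  by (simp add: hermitian_def sum_subtractf algebra_simps)

lemma hermitian_minus_left: "hermitian (- u) w = - hermitian u w"
  by (simp add: hermitian_def sum_negf)

lemma hermitian_minus_right: "hermitian u (- w) = - hermitian u w"
  by (simp add: hermitian_def sum_negf)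

lemma hermitian_smult_left: "hermitian (c *s u) w = c * hermitian u w"
  by (simp add: hermitian_def sum_distrib_left mult.assoc)

lemma hermitian_ebasis: "hermitian (ebasis i) (ebasis j) = (if i = j then 1 else 0)"
proof -
  have "ebasis i $ k * cnj (ebasis j $ k) = (if k = i then if i = j then 1 else 0 else 0)" for k
    by (simp add: ebasis_nth)
  then show ?thesis by (simp add: hermitian_def)
qed

lemma hermitian_vec_of:
  "hermitian (vec_of p) (vec_of q) =
     (if p = Origin \<or> q = Origin then 0 else if p = q then 1 else if p = opp q then -1 else 0)"
proof -
  have "hermitian 0 v = 0" "hermitian v 0 = 0" for v :: "complex ^ 'a"
    by (simp_all add: hermitian_def)
  then show ?thesis
    by (cases p; cases q) (auto simp: hermitian_minus_left hermitian_minus_right hermitian_ebasis)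
qed

lemma refl_along_diff: "refl_along \<alpha> (u - v) = refl_along \<alpha> u - refl_along \<alpha> v"
  by (simp add: refl_along_def hermitian_diff_left vec_eq_iff algebra_simps diff_divide_distrib)

lemma refl_along_0: "refl_along \<alpha> 0 = 0"
  using refl_along_diff[of \<alpha> 0 0] by simp

lemma refl_along_minus: "refl_along \<alpha> (- v) = - refl_along \<alpha> v"
  using refl_along_diff[of \<alpha> 0 v] by (simp add: refl_along_0)

lemma refl_along_self: "hermitian \<alpha> \<alpha> \<noteq> 0 \<Longrightarrow> refl_along \<alpha> \<alpha> = - \<alpha>"
  by (simp add: refl_along_def vec_eq_iff)

text \<open>A reflection negates the component along \<open>\<alpha>\<close>; if the image of \<open>v\<close> vanishes, so does that
  component, and \<open>v\<close> is fixed.\<close>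

lemma refl_along_eq_0:
  assumes "hermitian \<alpha> \<alpha> \<noteq> 0" "refl_along \<alpha> v = 0"
  shows "v = 0"
proof -
  have "hermitian (refl_along \<alpha> v) \<alpha> = - hermitian v \<alpha>"
    using assms(1) by (simp add: refl_along_def hermitian_diff_left hermitian_smult_left)
  moreover have "hermitian 0 \<alpha> = 0"
    by (simp add: hermitian_def)
  ultimately have "hermitian v \<alpha> = 0"
    using assms(2) by simp
  then show "v = 0"
    using assms(2) by (simp add: refl_along_def)
qed

lemma hermitian_root_nonzero:
  assumes "x \<noteq> y"
  shows "hermitian (vec_of x - vec_of y) (vec_of x - vec_of y) \<noteq> 0"
  using assms by (auto simp: hermitian_diff_left hermitian_diff_right hermitian_vec_of)

text \<open>Points other than the origin have the same length, so the reflection along \<open>x - y\<close> exchanges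
  \<open>x\<close> and \<open>y\<close> when neither is the origin; being linear, it also exchanges their opposites. Points on
  other axes are orthogonal to \<open>x - y\<close> and stay fixed. If \<open>x\<close> or \<open>y\<close> is the origin, the root is a
  signed basis vector and the reflection changes its sign.\<close>

lemma refl_along_vec_of:
  assumes "x \<noteq> y"
  obtains
    "refl_along (vec_of x - vec_of y) (vec_of p) = vec_of p"
  | "p \<in> {x, y, opp x, opp y}" "x = Origin \<or> y = Origin"
      "refl_along (vec_of x - vec_of y) (vec_of p) = vec_of (opp p)"
  | q where "(p, q) \<in> {(x, y), (y, x), (opp x, opp y), (opp y, opp x)}"
      "refl_along (vec_of x - vec_of y) (vec_of p) = vec_of q"
proof -
  let ?\<alpha> = "vec_of x - vec_of y"
  show ?thesis
  proof (cases "p \<in> {x, y, opp x, opp y}")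
    case False
    then have "hermitian (vec_of p) (vec_of x) = 0" "hermitian (vec_of p) (vec_of y) = 0"
      by (auto simp: hermitian_vec_of)
    then have "refl_along ?\<alpha> (vec_of p) = vec_of p"
      by (simp add: refl_along_def hermitian_diff_right)
    then show ?thesis using that(1) by blast
  next
    case True
    show ?thesis
    proof (cases "x = Origin \<or> y = Origin")
      case orig: True
      have self: "refl_along ?\<alpha> ?\<alpha> = - ?\<alpha>"
        by (rule refl_along_self[OF hermitian_root_nonzero[OF assms]])
      then have self': "refl_along ?\<alpha> (- ?\<alpha>) = ?\<alpha>"
        unfolding refl_along_minus by simp
      have "vec_of p \<in> {0, ?\<alpha>, - ?\<alpha>}"
        using orig True by auto
      then have "refl_along ?\<alpha> (vec_of p) = vec_of (opp p)"
        using self self' refl_along_0[of ?\<alpha>] by auto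
      then show ?thesis using that(2) orig True by blast
    next
      case False
      have h: "hermitian (vec_of x) (vec_of x) = 1" "hermitian (vec_of y) (vec_of y) = 1"
        "hermitian (vec_of y) (vec_of x) = (if x = opp y then -1 else 0)"
        "hermitian (vec_of x) (vec_of y) = (if x = opp y then -1 else 0)"
        using False assms by (auto simp: hermitian_vec_of)
      \<comment> \<open>For \<open>x = -y\<close> the root is twice a basis vector, and the quotients are \<open>\<plusminus>4/4\<close> instead of
        \<open>\<plusminus>2/2\<close>.\<close>
      have "2 * hermitian (vec_of x) ?\<alpha> / hermitian ?\<alpha> ?\<alpha> = 1"
        "2 * hermitian (vec_of y) ?\<alpha> / hermitian ?\<alpha> ?\<alpha> = - 1"
        by (simp_all add: hermitian_diff_left hermitian_diff_right h)
      then have x: "refl_along ?\<alpha> (vec_of x) = vec_of y"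
        and y: "refl_along ?\<alpha> (vec_of y) = vec_of x"
        unfolding refl_along_def by (simp_all add: vector_smult_lneg)
      from True consider "p = x" | "p = y" | "p = opp x" | "p = opp y" by blast
      then show ?thesis
      proof cases
        case 1 then show ?thesis using that(3)[of y] x by simp
      next
        case 2 then show ?thesis using that(3)[of x] y by simp
      next
        case 3 then show ?thesis using that(3)[of "opp y"] x by (simp add: refl_along_minus)
      next
        case 4 then show ?thesis using that(3)[of "opp x"] y by (simp add: refl_along_minus)
      qed
    qed
  qed
qed

section \<open>Closed root subsystems as equivalence relations\<close>

definition point_rel :: "(complex ^ 'n::finite) set \<Rightarrow> ('n point \<times> 'n point) set" where
  "point_rel \<Phi> = {(x, y). vec_of x - vec_of y \<in> insert 0 \<Phi>}"

text \<open>Invariance under the antipode is automatic, as both sides speak of the same difference.\<close>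

lemma point_rel_opp: "(opp y, opp x) \<in> point_rel \<Phi> \<longleftrightarrow> (x, y) \<in> point_rel \<Phi>"
  by (auto simp: point_rel_def)

lemma point_rel_iff: "(x, y) \<in> point_rel \<Phi> \<longleftrightarrow> x = y \<or> vec_of x - vec_of y \<in> \<Phi>"
  by (auto simp add: point_rel_def)

lemma zero_notin_BC: "0 \<notin> BC"
  by (auto simp: BC_eq_differences)

lemma closed_root_subsystem_imp_equiv:
  assumes "closed_root_subsystem \<Phi>"
  shows "equiv UNIV (point_rel \<Phi>)"
proof (rule equivI)
  have sub: "\<Phi> \<subseteq> BC" and refl: "\<And>\<alpha> \<beta>. \<alpha> \<in> \<Phi> \<Longrightarrow> \<beta> \<in> \<Phi> \<Longrightarrow> refl_along \<alpha> \<beta> \<in> \<Phi>"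
    and cl: "\<And>\<alpha> \<beta>. \<alpha> \<in> \<Phi> \<Longrightarrow> \<beta> \<in> \<Phi> \<Longrightarrow> \<alpha> + \<beta> \<in> BC \<Longrightarrow> \<alpha> + \<beta> \<in> \<Phi>"
    using assms unfolding closed_root_subsystem_def root_subsystem_def closed_in_BC_def by blast+
  show "point_rel \<Phi> \<subseteq> UNIV \<times> UNIV" by simp
  show "refl (point_rel \<Phi>)" by (simp add: refl_on_def point_rel_def)
  show "sym (point_rel \<Phi>)"
  proof (rule symI)
    fix x y assume xy: "(x, y) \<in> point_rel \<Phi>"
    show "(y, x) \<in> point_rel \<Phi>"
    proof (cases "x = y")
      case False
      then have "vec_of x - vec_of y \<in> \<Phi>" using xy by (simp add: point_rel_iff)
      with refl[OF this this] show ?thesis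
        using refl_along_self[OF hermitian_root_nonzero[OF False]] by (simp add: point_rel_iff)
    qed (use xy in simp)
  qed
  show "trans (point_rel \<Phi>)"
  proof (rule transI)
    fix x y z assume "(x, y) \<in> point_rel \<Phi>" "(y, z) \<in> point_rel \<Phi>"
    then show "(x, z) \<in> point_rel \<Phi>"
      using cl[of "vec_of x - vec_of y" "vec_of y - vec_of z"]
      by (auto simp: point_rel_iff BC_eq_differences)
  qed
qed

text \<open>The images in \<open>refl_along_vec_of\<close> are equivalent to the point itself. For a sign change
  this uses that one of \<open>x\<close>, \<open>y\<close> is the origin: then the origin is equivalent to \<open>p\<close> and, by the
  antipodal symmetry, to the opposite of \<open>p\<close>.\<close>

lemma refl_along_in_block:
  assumes eq: "equiv UNIV (point_rel \<Phi>)" and xy: "(x, y) \<in> point_rel \<Phi>" and "x \<noteq> y"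
  obtains q where "refl_along (vec_of x - vec_of y) (vec_of p) = vec_of q" "(p, q) \<in> point_rel \<Phi>"
proof -
  have sym: "\<And>p q. (p, q) \<in> point_rel \<Phi> \<Longrightarrow> (q, p) \<in> point_rel \<Phi>"
    and trans: "\<And>p q r. (p, q) \<in> point_rel \<Phi> \<Longrightarrow> (q, r) \<in> point_rel \<Phi> \<Longrightarrow> (p, r) \<in> point_rel \<Phi>"
    using eq by (meson equivE symE transE)+
  show ?thesis
  proof (cases rule: refl_along_vec_of[OF \<open>x \<noteq> y\<close>, of p])
    case 1
    then show ?thesis using that by (simp add: point_rel_iff)
  next
    case 2
    have z: "(p, Origin) \<in> point_rel \<Phi>"
      using 2(1,2) xy sym[OF xy] point_rel_opp[of Origin x \<Phi>] point_rel_opp[of Origin y \<Phi>]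
       point_rel_opp[of x Origin \<Phi>] point_rel_opp[of y Origin \<Phi>]
      by (auto simp: point_rel_iff)
    then have "(Origin, opp p) \<in> point_rel \<Phi>"
      using point_rel_opp[of Origin p] by simp
    then show ?thesis using 2(3) z trans that by blast
  next
    case (3 q)
    then show ?thesis using that xy sym point_rel_opp by blast
  qed
qed

lemma equiv_imp_closed_root_subsystem:
  assumes sub: "\<Phi> \<subseteq> BC" and eq: "equiv UNIV (point_rel \<Phi>)"
  shows "closed_root_subsystem \<Phi>"
proof -
  have sym: "\<And>p q. (p, q) \<in> point_rel \<Phi> \<Longrightarrow> (q, p) \<in> point_rel \<Phi>"
    and trans: "\<And>p q r. (p, q) \<in> point_rel \<Phi> \<Longrightarrow> (q, r) \<in> point_rel \<Phi> \<Longrightarrow> (p, r) \<in> point_rel \<Phi>"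
    using eq by (meson equivE symE transE)+
  have root: "\<exists>x y. x \<noteq> y \<and> \<alpha> = vec_of x - vec_of y" if "\<alpha> \<in> \<Phi>" for \<alpha>
    using that sub unfolding BC_eq_differences by blast
  have "\<alpha> + \<beta> \<in> \<Phi>" if in\<Phi>: "\<alpha> \<in> \<Phi>" "\<beta> \<in> \<Phi>" and BC: "\<alpha> + \<beta> \<in> BC" for \<alpha> \<beta>
  proof -
    obtain x y z where xyz: "\<alpha> = vec_of x - vec_of y" "\<beta> = vec_of y - vec_of z"
      by (rule root_sum_composable[OF subsetD[OF sub in\<Phi>(1)] subsetD[OF sub in\<Phi>(2)] BC])
    then have "(x, z) \<in> point_rel \<Phi>"
      using in\<Phi> trans[of x y z] by (simp add: point_rel_iff)
    moreover have "x \<noteq> z" using xyz BC zero_notin_BC by auto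
    ultimately show ?thesis using xyz by (simp add: point_rel_iff)
  qed
  moreover have "refl_along \<alpha> \<beta> \<in> \<Phi>" if in\<Phi>: "\<alpha> \<in> \<Phi>" "\<beta> \<in> \<Phi>" for \<alpha> \<beta>
  proof -
    obtain x y where xy: "x \<noteq> y" "\<alpha> = vec_of x - vec_of y" using root[OF in\<Phi>(1)] by metis
    obtain z w where zw: "z \<noteq> w" "\<beta> = vec_of z - vec_of w" using root[OF in\<Phi>(2)] by metis
    have rel: "(x, y) \<in> point_rel \<Phi>" "(z, w) \<in> point_rel \<Phi>"
      using xy zw in\<Phi> by (simp_all add: point_rel_iff)
    obtain z' where z': "refl_along \<alpha> (vec_of z) = vec_of z'" "(z, z') \<in> point_rel \<Phi>"
      unfolding xy(2) by (rule refl_along_in_block[OF eq rel(1) xy(1), of z])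
    obtain w' where w': "refl_along \<alpha> (vec_of w) = vec_of w'" "(w, w') \<in> point_rel \<Phi>"
      unfolding xy(2) by (rule refl_along_in_block[OF eq rel(1) xy(1), of w])
    have "(z', w') \<in> point_rel \<Phi>"
      by (rule trans[OF trans[OF sym[OF z'(2)] rel(2)] w'(2)])
    moreover have "refl_along \<alpha> \<beta> = vec_of z' - vec_of w'"
      using zw z' w' by (simp add: refl_along_diff)
    moreover have "refl_along \<alpha> \<beta> \<noteq> 0"
    proof
      assume "refl_along \<alpha> \<beta> = 0"
      then have "\<beta> = 0"
        unfolding xy(2) by (rule refl_along_eq_0[OF hermitian_root_nonzero[OF xy(1)]])
      then show False using zw by simp
    qed
    ultimately show ?thesis by (simp add: point_rel_def)
  qed
  ultimately show ?thesis
    using sub unfolding closed_root_subsystem_def root_subsystem_def closed_in_BC_def by auto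
qed

lemma closed_root_subsystem_iff:
  "closed_root_subsystem \<Phi> \<longleftrightarrow> \<Phi> \<subseteq> BC \<and> equiv UNIV (point_rel \<Phi>)"
proof
  assume *: "closed_root_subsystem \<Phi>"
  then show "\<Phi> \<subseteq> BC \<and> equiv UNIV (point_rel \<Phi>)"
    using closed_root_subsystem_imp_equiv by (simp add: closed_root_subsystem_def root_subsystem_def)
qed (simp add: equiv_imp_closed_root_subsystem)

section \<open>Closed crystallographs as equivalence relations\<close>

lemma difference_in_roots_of: "vec_of x - vec_of y \<in> roots_of G \<longleftrightarrow> linked G x y"
proof
  assume "vec_of x - vec_of y \<in> roots_of G"
  then obtain z w where zw: "linked G z w" "vec_of z - vec_of w = vec_of x - vec_of y"
    unfolding roots_of_eq_differences by force
  with difference_unique[OF linked_neq[OF zw(1)] zw(2)] show "linked G x y"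
    using linked_opp by blast
qed (auto simp: roots_of_eq_differences)

lemma equiv_roots_of_iff:
  "equiv UNIV (point_rel (roots_of G)) \<longleftrightarrow>
     (\<forall>x y z. linked G x y \<longrightarrow> linked G y z \<longrightarrow> x \<noteq> z \<longrightarrow> linked G x z)"
proof -
  have "refl (point_rel (roots_of G))" "sym (point_rel (roots_of G))"
    using linked_sym by (auto simp: refl_on_def sym_def point_rel_iff difference_in_roots_of)
  then have "equiv UNIV (point_rel (roots_of G)) \<longleftrightarrow> trans (point_rel (roots_of G))"
    by (auto simp: equiv_def)
  also have "\<dots> \<longleftrightarrow> (\<forall>x y z. linked G x y \<longrightarrow> linked G y z \<longrightarrow> x \<noteq> z \<longrightarrow> linked G x z)"
    unfolding trans_def point_rel_iff difference_in_roots_of by blast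
  finally show ?thesis .
qed

lemma straight_sym: "straight G c i j \<longleftrightarrow> straight G c j i"
  by (auto simp: straight_def insert_commute)

lemma linked_eq:
  "linked G (Pos i) Origin \<longleftrightarrow> loop G Red i" "linked G (Neg i) Origin \<longleftrightarrow> loop G Red i"
  "linked G Origin (Pos i) \<longleftrightarrow> loop G Red i" "linked G Origin (Neg i) \<longleftrightarrow> loop G Red i"
  "linked G (Pos i) (Pos j) \<longleftrightarrow> straight G Red i j"
  "linked G (Neg i) (Neg j) \<longleftrightarrow> straight G Red i j"
  "linked G (Pos i) (Neg j) \<longleftrightarrow> (if i = j then loop G Green i else straight G Green i j)"
  "linked G (Neg i) (Pos j) \<longleftrightarrow> (if i = j then loop G Green i else straight G Green i j)"
  by (auto simp: loop_def straight_def)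

text \<open>According to which of \<open>x\<close>, \<open>y\<close>, \<open>z\<close> are the origin, opposite, or over distinct nodes, one
  of the conditions on \<open>G\<close> applies. For instance \<open>e\<^sub>i \<sim> 0 \<sim> e\<^sub>j\<close> is the condition on two red loops,
  \<open>e\<^sub>i \<sim> 0 \<sim> -e\<^sub>i\<close> says that red loops come with green ones, \<open>e\<^sub>i \<sim> e\<^sub>j \<sim> -e\<^sub>i\<close> produces green loops
  from double edges, and three distinct nodes give the triangle condition.\<close>

lemma closed_crystallograph_imp_trans:
  assumes G: "closed_crystallograph G" and xyz: "linked G x y" "linked G y z" "x \<noteq> z"
  shows "linked G x z"
proof -
  have tri: "\<And>i j k c d. i \<noteq> k \<Longrightarrow> straight G c i j \<Longrightarrow> straight G d j k \<Longrightarrow>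
      straight G (if c = d then Red else Green) i k"
    using G unfolding closed_crystallograph_def crystallograph_def triangle_condition_def straight_def
    by blast
  have mono: "straight G Red i k" if "i \<noteq> k" "straight G c i j" "straight G c j k" for i j k c
    using tri[OF that] by simp
  have mixed: "straight G Green i k"
    if "i \<noteq> k" "straight G Red i j \<and> straight G Green j k \<or> straight G Green i j \<and> straight G Red j k"
    for i j k
    using that tri[of i k Red j Green] tri[of i k Green j Red] by auto
  have both: "\<And>i j c d e. loop G c i \<Longrightarrow> straight G d i j \<Longrightarrow> straight G e i j \<and> loop G c j"
    using G unfolding closed_crystallograph_def crystallograph_def by (metis colour.exhaust)
  have green: "\<And>i j. straight G Red i j \<Longrightarrow> straight G Green i j \<Longrightarrow> loop G Green i"
    and red: "\<And>i j c. i \<noteq> j \<Longrightarrow> loop G Red i \<Longrightarrow> loop G Red j \<Longrightarrow> straight G c i j"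
    and rg: "\<And>i. loop G Red i \<Longrightarrow> loop G Green i"
    using G unfolding closed_crystallograph_def closed_graph_def by (metis colour.exhaust)+
  note [simp] = linked_eq and [simp del] = linked.simps(2-)
  show ?thesis
    using xyz
    by (cases x; cases y; cases z; simp split: if_splits; metis straight_sym mono mixed both green red rg)
qed

text \<open>Most conditions are single instances of transitivity. Passing a green loop along an edge takes
  two steps: first the edge becomes a double edge, and this yields the green loop at the other end.\<close>

lemma trans_imp_closed_crystallograph:
  assumes bi: "bichromatic_graph G"
    and trans: "\<And>x y z. linked G x y \<Longrightarrow> linked G y z \<Longrightarrow> x \<noteq> z \<Longrightarrow> linked G x z"
  shows "closed_crystallograph G"
proof -
  note [simp] = linked_eq and [simp del] = linked.simps(2-)
  have neq: "i \<noteq> j" if "straight G c i j" for c i j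
    using that by (simp add: straight_def)
  have tri: "straight G (if c = d then Red else Green) i k"
    if "i \<noteq> k" "straight G c i j" "straight G d j k" for i j k c d
    using that neq[OF that(2)] neq[OF that(3)]
      trans[of "Pos i" "Pos j" "Pos k"] trans[of "Pos i" "Neg j" "Pos k"]
      trans[of "Pos i" "Pos j" "Neg k"] trans[of "Pos i" "Neg j" "Neg k"]
    by (cases c; cases d) auto
  have rg: "loop G Green i" if "loop G Red i" for i
    using that trans[of "Pos i" Origin "Neg i"] by simp
  have red: "straight G c i j" if "i \<noteq> j" "loop G Red i" "loop G Red j" for i j c
    using that trans[of "Pos i" Origin "Pos j"] trans[of "Pos i" Origin "Neg j"]
    by (cases c) auto
  have green: "loop G Green i" if "straight G Red i j" "straight G Green i j" for i j
    using that neq[OF that(1)] trans[of "Pos i" "Pos j" "Neg i"] straight_sym[of G Green i j] by auto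
  have both: "straight G e i j" if "loop G Green i" "straight G d i j" for i j d e
    using that neq[OF that(2)] trans[of "Pos i" "Neg i" "Pos j"] trans[of "Pos i" "Neg i" "Neg j"]
    by (cases d; cases e) auto
  have rloop: "loop G Red j" if "loop G Red i" "straight G d i j" for i j d
    using that neq[OF that(2)] trans[of Origin "Pos i" "Pos j"] trans[of Origin "Pos i" "Neg j"]
    by (cases d) auto
  have gloop: "loop G Green j" if "loop G Green i" "straight G d i j" for i j d
    using both[OF that, of Red] both[OF that, of Green] green[of j i]
      straight_sym[of G Red i j] straight_sym[of G Green i j] by simp
  have loop: "loop G c j" if "loop G c i" "straight G d i j" for i j c d
    using that rloop[of i d j] gloop[of i d j] by (cases c) simp_all
  have straight: "straight G e i j" if "loop G c i" "straight G d i j" for i j c d e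
    using that rg[of i] both[of i d j e] by (cases c) simp_all
  have triangle: "triangle_condition G"
    unfolding triangle_condition_def by (intro allI impI; elim conjE; rule tri)
  have "crystallograph G"
    unfolding crystallograph_def
    by (intro conjI allI impI bi triangle; elim conjE) (metis straight loop)+
  moreover have "closed_graph G"
    unfolding closed_graph_def
  proof (intro conjI allI impI bi triangle; (elim conjE)?)
    show "straight G (opposite c) i j" if "loop G Green i" "straight G c i j" for i j c
      using that by (rule straight)
    show "loop G Green i" if "straight G Red i j" "straight G Green i j" for i j
      using that by (rule green)
    show "loop G Green j" if "straight G Red i j" "straight G Green i j" for i j
      using that[THEN straight_sym[THEN iffD1]] by (rule green)
    show "loop G Red j" if "loop G Red i" "straight G c i j" for i j c
      using that by (rule rloop)
    show "straight G Red i j" "straight G Green i j" if "i \<noteq> j" "loop G Red i" "loop G Red j" for i j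
      using that by (rule red)+
    show "loop G Green i" if "loop G Red i" for i
      using that by (rule rg)
  qed
  ultimately show ?thesis
    by (simp add: closed_crystallograph_def)
qed

lemma closed_crystallograph_iff:
  "closed_crystallograph G \<longleftrightarrow> bichromatic_graph G \<and> equiv UNIV (point_rel (roots_of G))"
proof
  assume *: "closed_crystallograph G"
  then show "bichromatic_graph G \<and> equiv UNIV (point_rel (roots_of G))"
    using closed_crystallograph_imp_trans[OF *]
    by (auto simp: equiv_roots_of_iff closed_crystallograph_def crystallograph_def)
qed (auto simp: equiv_roots_of_iff intro!: trans_imp_closed_crystallograph)

section \<open>The bijection\<close>

lemma roots_of_subset_BC: "roots_of G \<subseteq> BC"
  unfolding roots_of_eq_differences BC_eq_differences using linked_neq by blast

text \<open>Edges and loops can be read off from the relation on points, which is determined by the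
  roots. This makes a graph recoverable from its roots.\<close>

lemma edge_iff_linked:
  "({i, j}, c) \<in> G \<longleftrightarrow>
     (if c = Green then linked G (Pos i) (Neg j)
      else if i = j then linked G (Pos i) Origin else linked G (Pos i) (Pos j))"
  by (cases c) auto

lemma bichromatic_edge:
  assumes "bichromatic_graph G" "(e, c) \<in> G"
  shows "\<exists>i j. e = {i, j}"
proof -
  have "(\<exists>i j. i \<noteq> j \<and> e = {i, j}) \<or> (\<exists>k. e = {k})"
    using assms unfolding bichromatic_graph_def by blast
  then show ?thesis by (metis insert_absorb2)
qed

lemma inj_on_roots_of: "inj_on roots_of {G. bichromatic_graph G}"
proof (rule inj_onI)
  fix G H :: "'n::finite cgraph"
  assume G: "G \<in> {G. bichromatic_graph G}" and H: "H \<in> {G. bichromatic_graph G}"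
    and eq: "roots_of G = roots_of H"
  have "linked G = linked H"
    using eq by (intro ext) (simp flip: difference_in_roots_of)
  then have edges: "({i, j}, c) \<in> G \<longleftrightarrow> ({i, j}, c) \<in> H" for i j c
    by (simp only: edge_iff_linked)
  have "\<exists>i j. e = {i, j}" if "(e, c) \<in> G \<or> (e, c) \<in> H" for e c
    using that bichromatic_edge[of G e c] bichromatic_edge[of H e c] G H by blast
  with edges have "(e, c) \<in> G \<longleftrightarrow> (e, c) \<in> H" for e c
    by metis
  then show "G = H" by auto
qed

text \<open>Each edge contributes a root together with its negative, so the sets of roots that come from
  graphs are those with a symmetric relation.\<close>

lemma symmetric_is_roots_of:
  assumes sub: "\<Phi> \<subseteq> BC" and sym: "sym (point_rel \<Phi>)"
  obtains G where "bichromatic_graph G" "roots_of G = \<Phi>"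
proof
  define G where "G =
    {({i, j}, Red) | i j. i \<noteq> j \<and> (Pos i, Pos j) \<in> point_rel \<Phi>}
    \<union> {({i, j}, Green) | i j. (Pos i, Neg j) \<in> point_rel \<Phi>}
    \<union> {({i}, Red) | i. (Pos i, Origin) \<in> point_rel \<Phi>}"
  show "bichromatic_graph G"
    by (auto simp: bichromatic_graph_def G_def)
  have s: "(p, q) \<in> point_rel \<Phi> \<Longrightarrow> (q, p) \<in> point_rel \<Phi>" for p q
    using sym by (meson symE)
  have o: "(p, q) \<in> point_rel \<Phi> \<Longrightarrow> (opp p, opp q) \<in> point_rel \<Phi>" for p q
    using s point_rel_opp by blast
  have red: "({i, j}, Red) \<in> G \<longleftrightarrow> (Pos i, Pos j) \<in> point_rel \<Phi>" if "i \<noteq> j" for i j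
    using that s by (auto simp: G_def doubleton_eq_iff)
  have green: "({i, j}, Green) \<in> G \<longleftrightarrow> (Pos i, Neg j) \<in> point_rel \<Phi>" for i j
    using s[of "Pos i" "Neg j"] s[of "Pos j" "Neg i"] o[of "Neg j" "Pos i"] o[of "Neg i" "Pos j"]
    by (auto simp: G_def doubleton_eq_iff)
  have rloop: "({i}, Red) \<in> G \<longleftrightarrow> (Pos i, Origin) \<in> point_rel \<Phi>" for i
    by (auto simp: G_def)
  \<comment> \<open>A green loop is written as the green edge \<open>{i, i}\<close> in the definition of \<open>G\<close>.\<close>
  have lg: "({i}, Green) \<in> G \<longleftrightarrow> (Pos i, Neg i) \<in> point_rel \<Phi>" for i
    using green[of i i] by simp
  have neg: "(Neg i, q) \<in> point_rel \<Phi> \<longleftrightarrow> (Pos i, opp q) \<in> point_rel \<Phi>" for i q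
    using o[of "Neg i" q, unfolded opp.simps] o[of "Pos i" "opp q", unfolded opp.simps opp_opp] by blast
  have orig: "(Origin, Pos i) \<in> point_rel \<Phi> \<longleftrightarrow> (Pos i, Origin) \<in> point_rel \<Phi>"
    "(Origin, Neg i) \<in> point_rel \<Phi> \<longleftrightarrow> (Pos i, Origin) \<in> point_rel \<Phi>" for i
    using s[of Origin "Pos i"] s[of "Pos i" Origin] s[of Origin "Neg i"] s[of "Neg i" Origin]
      neg[of i Origin, unfolded opp.simps] by blast+
  have linked: "linked G x y \<longleftrightarrow> (x, y) \<in> point_rel \<Phi>" if "x \<noteq> y" for x y
    using that by (cases x; cases y) (auto simp: red green rloop lg neg orig)
  show "roots_of G = \<Phi>"
  proof
    show "roots_of G \<subseteq> \<Phi>"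
    proof
      fix \<alpha> assume "\<alpha> \<in> roots_of G"
      then obtain x y where xy: "linked G x y" "\<alpha> = vec_of x - vec_of y"
        unfolding roots_of_eq_differences by blast
      then show "\<alpha> \<in> \<Phi>"
        using linked linked_neq[OF xy(1)] by (simp add: point_rel_iff)
    qed
    show "\<Phi> \<subseteq> roots_of G"
    proof
      fix \<alpha> assume \<alpha>: "\<alpha> \<in> \<Phi>"
      then obtain x y where "x \<noteq> y" "\<alpha> = vec_of x - vec_of y"
        using sub unfolding BC_eq_differences by blast
      then show "\<alpha> \<in> roots_of G"
        using \<alpha> linked by (simp add: difference_in_roots_of point_rel_iff)
    qed
  qed
qed

theorem corollary8p2p1:
  shows "bij_betw (roots_of :: 'n::finite cgraph \<Rightarrow> (complex ^ 'n) set)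
           {G. closed_crystallograph G} {\<Phi>. closed_root_subsystem \<Phi>}"
proof (rule bij_betw_imageI)
  show "inj_on (roots_of :: 'n cgraph \<Rightarrow> _) {G. closed_crystallograph G}"
    by (rule inj_on_subset[OF inj_on_roots_of]) (auto simp: closed_crystallograph_iff)
  show "(roots_of :: 'n cgraph \<Rightarrow> _) ` {G. closed_crystallograph G} = {\<Phi>. closed_root_subsystem \<Phi>}"
  proof (intro equalityI subsetI)
    fix \<Phi> :: "(complex ^ 'n) set"
    assume "\<Phi> \<in> {\<Phi>. closed_root_subsystem \<Phi>}"
    then have \<Phi>: "\<Phi> \<subseteq> BC" "equiv UNIV (point_rel \<Phi>)"
      by (simp_all add: closed_root_subsystem_iff)
    then obtain G where "bichromatic_graph G" "roots_of G = \<Phi>"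
      using symmetric_is_roots_of by (metis equivE)
    with \<Phi> show "\<Phi> \<in> roots_of ` {G. closed_crystallograph G}"
      by (auto simp: closed_crystallograph_iff)
  qed (auto simp: closed_crystallograph_iff closed_root_subsystem_iff
      intro: roots_of_subset_BC[THEN subsetD])
qed

end
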